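(* Let $\mathcal{M} = (\mathcal{S}, \mathcal{A}, P, R, \gamma)$ be a Markov decision process with binary rewards $r_t \in \{0,1\}$ and discount factor $\gamma \in (0,1)$, and let $H \ge 1$ be an integer. For any chunking policy $\pi$ with execution horizons $h_k \in \{1,\dots,H\}$, with chunk start times $t_0 = 0$, $t_{k+1} = t_k + h_k$ and within-chunk discounted rewards $\bar{R}_k = \sum_{j=0}^{h_k-1} \gamma^j r_{t_k+j}$, and for any initial state $s \in \mathcal{S}$, $$ \mathbb{E}_\pi\left[ \sum_{k\geq 0} \gamma^{t_k} \bar{R}_k \;\middle|\; s_{t_0}=s \right] = \mathbb{E}_\pi\left[ \sum_{t\geq 0} \gamma^t r_t \;\middle|\; s_0=s \right]. $$
   Context: $\mathcal{M} = (\mathcal{S}, \mathcal{A}, P, R, \gamma)$ is a Markov decision process with state space $\mathcal{S}$, action space $\mathcal{A}$, transition dynamics (Markov kernel) $P$, binary reward function $R$ (so each per-step reward lies in $\{0,1\}$), and discount factor $\gamma \in (0,1)$. Usual measurability is assumed. Chunking policy. Fix a maximal chunk length $H \ge 1$. A chunking policy $\pi$ assigns to each state $s$ a joint distribution over an action chunk $\mathbf{a}_{1:H} = (a_1,\dots,a_H) \in \mathcal{A}^H$ and an execution horizon $h \in \{1,\dots,H\}$, factored as $$\pi(\mathbf{a}_{1:H}, h \mid s) = \pi_{\mathrm{act}}(\mathbf{a}_{1:H} \mid s)\, \pi_{\mathrm{len}}(h \mid s, \mathbf{a}_{1:H}),$$ where $\pi_{\mathrm{act}}(\cdot\mid s)$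 is a distribution on $\mathcal{A}^H$ and $\pi_{\mathrm{len}}(\cdot \mid s, \mathbf{a}_{1:H})$ is a categorical distribution on $\{1,\dots,H\}$. Rollout. Decisions are made at the (random) chunk start times $t_0 = 0$, $t_{k+1} = t_k + h_k$. At time $t_k$, in state $s_{t_k}$, the pair $(\mathbf{a}^{(k)}_{1:H}, h_k)$ is sampled from $\pi(\cdot,\cdot \mid s_{t_k})$. The first $h_k$ actions of the chunk are then executed open-loop: the action applied at environment step $t_k + j$ is $a^{(k)}_{j+1}$ for $0 \le j \le h_k - 1$, with states evolving according to $P$ at every environment step. The remaining $H - h_k$ actions are discarded, and a new chunk and horizon are sampled at time $t_{k+1}$. For every environment step $t \ge 0$, $s_t$ is the state and $r_t \in \{0,1\}$ is the reward given by $R$ for the transition at step $t$. $\mathbb{E}_\pi[\,\cdot \mid s_0 = s]$ is the expectation over the resulting infinite trajectory started at $s$; since $t_0 = 0$, conditioning on $s_{t_0}=s$ is the same as conditioning on $s_0=s$. *)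

theory Defs
  imports "HOL-Probability.Probability"
begin

text \<open>
  \<open>S\<close> and \<open>A\<close> are the measurable spaces of states and actions. The reward of a transition may depend
  on the state, the action and the successor state.
\<close>

locale binary_mdp =
  fixes S :: "'s measure" and A :: "'a measure"
    and P :: "'s \<times> 'a \<Rightarrow> 's measure"
    and R :: "'s \<times> 'a \<times> 's \<Rightarrow> real"
    and \<gamma> :: real
  assumes P_kernel: "P \<in> S \<Otimes>\<^sub>M A \<rightarrow>\<^sub>M prob_algebra S"
    and R_measurable: "R \<in> borel_measurable (S \<Otimes>\<^sub>M A \<Otimes>\<^sub>M S)"
    and R_binary: "\<And>x. x \<in> space (S \<Otimes>\<^sub>M A \<Otimes>\<^sub>M S) \<Longrightarrow> R x \<in> {0, 1}"
    and \<gamma>_bounds: "0 < \<gamma>" "\<gamma> < 1"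

text \<open>A chunk \<open>(a\<^sub>1, \<dots>, a\<^sub>H)\<close> is an extensional function on \<open>{1..H}\<close>.\<close>

definition chunk_space :: "'a measure \<Rightarrow> nat \<Rightarrow> (nat \<Rightarrow> 'a) measure" where
  "chunk_space A H = (\<Pi>\<^sub>M i\<in>{1..H}. A)"

definition horizon_space :: "nat \<Rightarrow> nat measure" where
  "horizon_space H = count_space {1..H}"

locale chunking_policy =
  fixes S :: "'s measure" and A :: "'a measure" and H :: nat
    and \<pi>act :: "'s \<Rightarrow> (nat \<Rightarrow> 'a) measure"
    and \<pi>len :: "'s \<times> (nat \<Rightarrow> 'a) \<Rightarrow> nat measure"
  assumes H_pos: "1 \<le> H"
    and act_kernel: "\<pi>act \<in> S \<rightarrow>\<^sub>M prob_algebra (chunk_space A H)"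
    and len_kernel: "\<pi>len \<in> S \<Otimes>\<^sub>M chunk_space A H \<rightarrow>\<^sub>M prob_algebra (horizon_space H)"

definition joint_policy ::
    "'a measure \<Rightarrow> nat \<Rightarrow> ('s \<Rightarrow> (nat \<Rightarrow> 'a) measure) \<Rightarrow> ('s \<times> (nat \<Rightarrow> 'a) \<Rightarrow> nat measure)
      \<Rightarrow> 's \<Rightarrow> ((nat \<Rightarrow> 'a) \<times> nat) measure" where
  "joint_policy A H \<pi>act \<pi>len s =
     \<pi>act s \<bind> (\<lambda>a. \<pi>len (s, a) \<bind>
       (\<lambda>h. return (chunk_space A H \<Otimes>\<^sub>M horizon_space H) (a, h)))"

text \<open>
  What is recorded at an environment step \<open>t\<close> is the tuple \<open>(s, a, h, j)\<close> of the state \<open>s\<close> at time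
  \<open>t\<close>, the chunk \<open>a\<close> being executed and its execution horizon \<open>h\<close>, and the number \<open>j < h\<close> of actions
  of the chunk that were executed before time \<open>t\<close>. The action applied at time \<open>t\<close> is thus \<open>a (j + 1)\<close>.
\<close>

type_synonym ('s, 'a) config = "'s \<times> (nat \<Rightarrow> 'a) \<times> nat \<times> nat"

definition config_space :: "'s measure \<Rightarrow> 'a measure \<Rightarrow> nat \<Rightarrow> ('s, 'a) config measure" where
  "config_space S A H =
     S \<Otimes>\<^sub>M chunk_space A H \<Otimes>\<^sub>M horizon_space H \<Otimes>\<^sub>M count_space {..<H}"

definition decide ::
    "'s measure \<Rightarrow> 'a measure \<Rightarrow> nat \<Rightarrow> ('s \<Rightarrow> (nat \<Rightarrow> 'a) measure)
      \<Rightarrow> ('s \<times> (nat \<Rightarrow> 'a) \<Rightarrow> nat measure) \<Rightarrow> 's \<Rightarrow> ('s, 'a) config measure" where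
  "decide S A H \<pi>act \<pi>len s =
     joint_policy A H \<pi>act \<pi>len s \<bind> (\<lambda>(a, h). return (config_space S A H) (s, a, h, 0))"

definition env_step ::
    "'s measure \<Rightarrow> 'a measure \<Rightarrow> ('s \<times> 'a \<Rightarrow> 's measure) \<Rightarrow> nat \<Rightarrow> ('s \<Rightarrow> (nat \<Rightarrow> 'a) measure)
      \<Rightarrow> ('s \<times> (nat \<Rightarrow> 'a) \<Rightarrow> nat measure) \<Rightarrow> ('s, 'a) config \<Rightarrow> ('s, 'a) config measure" where
  "env_step S A P H \<pi>act \<pi>len = (\<lambda>(s, a, h, j).
     P (s, a (j + 1)) \<bind> (\<lambda>s'.
       if j + 1 < h then return (config_space S A H) (s', a, h, j + 1)
       else decide S A H \<pi>act \<pi>len s'))"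

definition rollout_kernel ::
    "'s measure \<Rightarrow> 'a measure \<Rightarrow> ('s \<times> 'a \<Rightarrow> 's measure) \<Rightarrow> nat \<Rightarrow> ('s \<Rightarrow> (nat \<Rightarrow> 'a) measure)
      \<Rightarrow> ('s \<times> (nat \<Rightarrow> 'a) \<Rightarrow> nat measure) \<Rightarrow> 's
      \<Rightarrow> nat \<Rightarrow> (nat \<Rightarrow> ('s, 'a) config) \<Rightarrow> ('s, 'a) config measure" where
  "rollout_kernel S A P H \<pi>act \<pi>len s n \<omega> =
     (if n = 0 then decide S A H \<pi>act \<pi>len s else env_step S A P H \<pi>act \<pi>len (\<omega> (n - 1)))"

text \<open>
  The law of the infinite trajectory started at \<open>s\<close>, by the Ionescu-Tulcea extension of the one-step
  kernels. The locale instance \<open>rollout_Ionescu_Tulcea\<close> below justifies the use of the extension.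
\<close>

definition rollout_law ::
    "'s measure \<Rightarrow> 'a measure \<Rightarrow> ('s \<times> 'a \<Rightarrow> 's measure) \<Rightarrow> nat \<Rightarrow> ('s \<Rightarrow> (nat \<Rightarrow> 'a) measure)
      \<Rightarrow> ('s \<times> (nat \<Rightarrow> 'a) \<Rightarrow> nat measure) \<Rightarrow> 's \<Rightarrow> (nat \<Rightarrow> ('s, 'a) config) measure" where
  "rollout_law S A P H \<pi>act \<pi>len s =
     projective_family.lim UNIV
       (Ionescu_Tulcea.CI (rollout_kernel S A P H \<pi>act \<pi>len s) (\<lambda>_. config_space S A H))
       (\<lambda>_. config_space S A H)"

definition state_at :: "(nat \<Rightarrow> ('s, 'a) config) \<Rightarrow> nat \<Rightarrow> 's" where
  "state_at \<omega> t = (case \<omega> t of (s, a, h, j) \<Rightarrow> s)"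

definition action_at :: "(nat \<Rightarrow> ('s, 'a) config) \<Rightarrow> nat \<Rightarrow> 'a" where
  "action_at \<omega> t = (case \<omega> t of (s, a, h, j) \<Rightarrow> a (j + 1))"

definition horizon_at :: "(nat \<Rightarrow> ('s, 'a) config) \<Rightarrow> nat \<Rightarrow> nat" where
  "horizon_at \<omega> t = (case \<omega> t of (s, a, h, j) \<Rightarrow> h)"

definition reward_at ::
    "('s \<times> 'a \<times> 's \<Rightarrow> real) \<Rightarrow> (nat \<Rightarrow> ('s, 'a) config) \<Rightarrow> nat \<Rightarrow> real" where
  "reward_at R \<omega> t = R (state_at \<omega> t, action_at \<omega> t, state_at \<omega> (t + 1))"

text \<open>
  Almost surely, \<open>j = 0\<close> in the tuple recorded at time \<open>t\<^sub>k\<close>, and the horizon found there is the one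
  sampled at that time: a horizon \<open>h\<close> sampled at \<open>t\<^sub>k\<close> is kept until \<open>t\<^sub>k + h - 1\<close>, where \<open>j + 1 = h\<close>,
  and the next step samples afresh.
\<close>

primrec chunk_start :: "(nat \<Rightarrow> ('s, 'a) config) \<Rightarrow> nat \<Rightarrow> nat" where
  "chunk_start \<omega> 0 = 0"
| "chunk_start \<omega> (Suc k) = chunk_start \<omega> k + horizon_at \<omega> (chunk_start \<omega> k)"

definition chunk_horizon :: "(nat \<Rightarrow> ('s, 'a) config) \<Rightarrow> nat \<Rightarrow> nat" where
  "chunk_horizon \<omega> k = horizon_at \<omega> (chunk_start \<omega> k)"

definition chunk_reward ::
    "('s \<times> 'a \<times> 's \<Rightarrow> real) \<Rightarrow> real \<Rightarrow> (nat \<Rightarrow> ('s, 'a) config) \<Rightarrow> nat \<Rightarrow> real" where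
  "chunk_reward R \<gamma> \<omega> k =
     (\<Sum>j<chunk_horizon \<omega> k. \<gamma> ^ j * reward_at R \<omega> (chunk_start \<omega> k + j))"

locale chunked_rollout = binary_mdp S A P R \<gamma> + chunking_policy S A H \<pi>act \<pi>len
  for S :: "'s measure" and A :: "'a measure" and P R \<gamma> H \<pi>act \<pi>len
begin

declare P_kernel[measurable] act_kernel[measurable] len_kernel[measurable] R_measurable[measurable]

lemma joint_policy_kernel[measurable]:
  "joint_policy A H \<pi>act \<pi>len \<in> S \<rightarrow>\<^sub>M prob_algebra (chunk_space A H \<Otimes>\<^sub>M horizon_space H)"
  unfolding joint_policy_def[abs_def] by measurable

lemma decide_kernel[measurable]:
  "decide S A H \<pi>act \<pi>len \<in> S \<rightarrow>\<^sub>M prob_algebra (config_space S A H)"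
proof -
  have [measurable]: "(\<lambda>(s, a, h). (s, a, h, 0::nat))
      \<in> S \<Otimes>\<^sub>M (chunk_space A H \<Otimes>\<^sub>M horizon_space H) \<rightarrow>\<^sub>M config_space S A H"
    unfolding config_space_def by measurable (use H_pos in auto)
  have "(\<lambda>(s, x). case x of (a, h) \<Rightarrow> return (config_space S A H) (s, a, h, 0))
      \<in> S \<Otimes>\<^sub>M (chunk_space A H \<Otimes>\<^sub>M horizon_space H) \<rightarrow>\<^sub>M prob_algebra (config_space S A H)"
    using measurable_compose[OF \<open>(\<lambda>(s, a, h). (s, a, h, 0::nat)) \<in> _\<close> measurable_return_prob_space]
    by (simp add: split_beta')
  then show ?thesis
    unfolding decide_def[abs_def]
    by (intro measurable_bind_prob_space2[OF joint_policy_kernel]) (simp add: split_beta')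
qed

lemma config_projections:
  shows state_measurable: "(\<lambda>x. fst x) \<in> config_space S A H \<rightarrow>\<^sub>M S"
    and chunk_measurable: "(\<lambda>x. fst (snd x)) \<in> config_space S A H \<rightarrow>\<^sub>M chunk_space A H"
    and horizon_measurable: "(\<lambda>x. fst (snd (snd x))) \<in> config_space S A H \<rightarrow>\<^sub>M horizon_space H"
    and phase_measurable: "(\<lambda>x. snd (snd (snd x))) \<in> config_space S A H \<rightarrow>\<^sub>M count_space {..<H}"
  unfolding config_space_def by measurable

lemma action_measurable:
  "(\<lambda>x. fst (snd x) (snd (snd (snd x)) + 1)) \<in> config_space S A H \<rightarrow>\<^sub>M A"
proof (rule measurable_compose_countable'[where f = "\<lambda>j x. fst (snd x) (j + 1)", OF _ phase_measurable])
  fix j assume "j \<in> {..<H}"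
  then have "(\<lambda>a. a (j + 1)) \<in> chunk_space A H \<rightarrow>\<^sub>M A"
    unfolding chunk_space_def by (intro measurable_component_singleton) auto
  then show "(\<lambda>x. fst (snd x) (j + 1)) \<in> config_space S A H \<rightarrow>\<^sub>M A"
    by (rule measurable_compose[OF chunk_measurable])
qed auto

lemma env_step_kernel[measurable]:
  "env_step S A P H \<pi>act \<pi>len \<in> config_space S A H \<rightarrow>\<^sub>M prob_algebra (config_space S A H)"
proof -
  let ?C = "config_space S A H"
  note st = state_measurable and ch = chunk_measurable and ho = horizon_measurable
    and ph = phase_measurable and act = action_measurable
  define nxt where "nxt x = (if snd (snd (snd x)) + 1 < fst (snd (snd x)) then snd (snd (snd x)) + 1 else 0)"
    for x :: "('s, 'a) config"
  have "(\<lambda>x. (fst (snd (snd x)), snd (snd (snd x)))) \<in> ?C \<rightarrow>\<^sub>M horizon_space H \<Otimes>\<^sub>M count_space {..<H}"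
    by (rule measurable_Pair[OF ho ph])
  then have pr: "(\<lambda>x. (fst (snd (snd x)), snd (snd (snd x)))) \<in> ?C \<rightarrow>\<^sub>M count_space ({1..H} \<times> {..<H})"
    by (simp add: horizon_space_def pair_measure_countable)
  have nxt: "nxt \<in> ?C \<rightarrow>\<^sub>M count_space {..<H}"
  proof -
    have "(\<lambda>(h, j). if j + 1 < h then j + 1 else 0)
        \<in> count_space ({1..H} \<times> {..<H}) \<rightarrow>\<^sub>M count_space {..<H}"
      using H_pos by auto
    from measurable_compose[OF pr this] show ?thesis
      by (simp add: nxt_def[abs_def] split_beta')
  qed
  have cont: "Measurable.pred ?C (\<lambda>x. snd (snd (snd x)) + 1 < fst (snd (snd x)))"
  proof -
    have "(\<lambda>(h, j). j + 1 < h) \<in> count_space ({1..H} \<times> {..<H}) \<rightarrow>\<^sub>M count_space UNIV"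
      by simp
    from measurable_compose[OF pr this] show ?thesis
      by (simp add: split_beta')
  qed
  have kernel: "(\<lambda>x. if snd (snd (snd (fst x))) + 1 < fst (snd (snd (fst x)))
         then return ?C (snd x, fst (snd (fst x)), fst (snd (snd (fst x))), nxt (fst x))
         else decide S A H \<pi>act \<pi>len (snd x)) \<in> ?C \<Otimes>\<^sub>M S \<rightarrow>\<^sub>M prob_algebra ?C"
  proof (rule measurable_If)
    have "(\<lambda>x. (snd x, fst (snd (fst x)), fst (snd (snd (fst x))), nxt (fst x)))
        \<in> ?C \<Otimes>\<^sub>M S \<rightarrow>\<^sub>M S \<Otimes>\<^sub>M chunk_space A H \<Otimes>\<^sub>M horizon_space H \<Otimes>\<^sub>M count_space {..<H}"
      by (intro measurable_Pair measurable_snd measurable_compose[OF measurable_fst ch]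
          measurable_compose[OF measurable_fst ho] measurable_compose[OF measurable_fst nxt])
    then have "(\<lambda>x. (snd x, fst (snd (fst x)), fst (snd (snd (fst x))), nxt (fst x)))
        \<in> ?C \<Otimes>\<^sub>M S \<rightarrow>\<^sub>M ?C"
      by (simp add: config_space_def)
    from measurable_compose[OF this measurable_return_prob_space]
    show "(\<lambda>x. return ?C (snd x, fst (snd (fst x)), fst (snd (snd (fst x))), nxt (fst x)))
        \<in> ?C \<Otimes>\<^sub>M S \<rightarrow>\<^sub>M prob_algebra ?C" .
    show "(\<lambda>x. decide S A H \<pi>act \<pi>len (snd x)) \<in> ?C \<Otimes>\<^sub>M S \<rightarrow>\<^sub>M prob_algebra ?C"
      by (rule measurable_compose[OF measurable_snd decide_kernel])
    show "{x \<in> space (?C \<Otimes>\<^sub>M S). snd (snd (snd (fst x))) + 1 < fst (snd (snd (fst x)))}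
        \<in> sets (?C \<Otimes>\<^sub>M S)"
      using measurable_compose[OF measurable_fst cont, of S] by (simp add: pred_def)
  qed
  have "(\<lambda>x. P (fst x, fst (snd x) (snd (snd (snd x)) + 1)) \<bind> (\<lambda>s'.
      if snd (snd (snd x)) + 1 < fst (snd (snd x))
      then return ?C (s', fst (snd x), fst (snd (snd x)), nxt x)
      else decide S A H \<pi>act \<pi>len s')) \<in> ?C \<rightarrow>\<^sub>M prob_algebra ?C"
    using kernel measurable_compose[OF measurable_Pair[OF st act] P_kernel]
    by (intro measurable_bind_prob_space2[where N = S]) (simp_all only: split_beta')
  moreover have "(if snd (snd (snd x)) + 1 < fst (snd (snd x))
      then return ?C (s', fst (snd x), fst (snd (snd x)), nxt x)
      else decide S A H \<pi>act \<pi>len s') =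
     (if snd (snd (snd x)) + 1 < fst (snd (snd x))
      then return ?C (s', fst (snd x), fst (snd (snd x)), snd (snd (snd x)) + 1)
      else decide S A H \<pi>act \<pi>len s')" for x s'
    by (simp add: nxt_def)
  ultimately show ?thesis
    by (simp only: env_step_def split_beta')
qed

lemma rollout_Ionescu_Tulcea:
  assumes s: "s \<in> space S"
  shows "Ionescu_Tulcea (rollout_kernel S A P H \<pi>act \<pi>len s) (\<lambda>_. config_space S A H)"
proof -
  let ?C = "config_space S A H"
  have k: "rollout_kernel S A P H \<pi>act \<pi>len s n \<in> PiM {0..<n} (\<lambda>_. ?C) \<rightarrow>\<^sub>M prob_algebra ?C" for n
  proof (cases n)
    case 0
    then show ?thesis
      using measurable_space[OF decide_kernel s]
      by (simp add: rollout_kernel_def[abs_def])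
  next
    case (Suc m)
    have "(\<lambda>\<omega>. \<omega> m) \<in> PiM {0..<n} (\<lambda>_. ?C) \<rightarrow>\<^sub>M ?C"
      by (rule measurable_component_singleton) (simp add: Suc)
    from measurable_compose[OF this env_step_kernel] show ?thesis
      by (simp add: rollout_kernel_def[abs_def] Suc)
  qed
  show ?thesis
  proof (rule Ionescu_Tulcea.intro)
    show "rollout_kernel S A P H \<pi>act \<pi>len s n \<in> PiM {0..<n} (\<lambda>_. ?C) \<rightarrow>\<^sub>M subprob_algebra ?C" for n
      by (rule measurable_prob_algebraD[OF k])
    show "prob_space (rollout_kernel S A P H \<pi>act \<pi>len s n \<omega>)"
      if "\<omega> \<in> space (PiM {0..<n} (\<lambda>_. ?C))" for n \<omega>
      using measurable_space[OF k that] by (simp add: space_prob_algebra)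
  qed
qed

lemma sets_rollout_law[measurable_cong]:
  assumes s: "s \<in> space S"
  shows "sets (rollout_law S A P H \<pi>act \<pi>len s) = sets (PiM UNIV (\<lambda>_. config_space S A H))"
proof -
  interpret Ionescu_Tulcea "rollout_kernel S A P H \<pi>act \<pi>len s" "\<lambda>_. config_space S A H"
    by (rule rollout_Ionescu_Tulcea[OF s])
  show ?thesis by (simp add: rollout_law_def)
qed

lemma prob_space_rollout_law:
  assumes s: "s \<in> space S"
  shows "prob_space (rollout_law S A P H \<pi>act \<pi>len s)"
proof -
  interpret Ionescu_Tulcea "rollout_kernel S A P H \<pi>act \<pi>len s" "\<lambda>_. config_space S A H"
    by (rule rollout_Ionescu_Tulcea[OF s])
  have emb: "PF.emb UNIV {} {\<lambda>_. undefined} = space (PiM UNIV (\<lambda>_. config_space S A H))"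
    by (auto simp: prod_emb_def space_PiM)
  have "emeasure (CI {}) (space (CI {})) = 1"
    by (rule prob_space.emeasure_space_1) (simp add: PF.prob_space_P)
  then have "emeasure (CI {}) {\<lambda>_. undefined} = 1"
    by (simp add: PF.space_P space_PiM_empty)
  then have "emeasure PF.lim (PF.emb UNIV {} {\<lambda>_. undefined}) = 1"
    by (subst lim) (simp_all add: sets_PiM_empty)
  then show ?thesis
    unfolding rollout_law_def emb by (intro prob_spaceI) simp
qed

lemma component_kernel:
  "(\<lambda>\<omega>. \<omega> t) \<in> PiM UNIV (\<lambda>_. config_space S A H) \<rightarrow>\<^sub>M config_space S A H"
  by (rule measurable_component_singleton) simp

lemma transition_measurable:
  "(\<lambda>\<omega>. (state_at \<omega> t, action_at \<omega> t, state_at \<omega> (t + 1)))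
     \<in> PiM UNIV (\<lambda>_. config_space S A H) \<rightarrow>\<^sub>M S \<Otimes>\<^sub>M A \<Otimes>\<^sub>M S"
  unfolding state_at_def action_at_def split_beta'
  by (intro measurable_Pair measurable_compose[OF component_kernel state_measurable]
      measurable_compose[OF component_kernel action_measurable])

lemma reward_measurable:
  "(\<lambda>\<omega>. reward_at R \<omega> t) \<in> borel_measurable (PiM UNIV (\<lambda>_. config_space S A H))"
  unfolding reward_at_def by (rule measurable_compose[OF transition_measurable R_measurable])

lemma reward_binary:
  assumes "\<omega> \<in> space (PiM UNIV (\<lambda>_. config_space S A H))"
  shows "reward_at R \<omega> t \<in> {0, 1}"
  unfolding reward_at_def by (rule R_binary[OF measurable_space[OF transition_measurable assms]])

lemma discounted_summable:
  assumes "\<omega> \<in> space (PiM UNIV (\<lambda>_. config_space S A H))"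
  shows "summable (\<lambda>t. \<gamma> ^ t * reward_at R \<omega> t)"
proof (rule summable_comparison_test')
  show "summable (\<lambda>t. \<gamma> ^ t)"
    using \<gamma>_bounds by (intro summable_geometric) auto
  show "norm (\<gamma> ^ t * reward_at R \<omega> t) \<le> \<gamma> ^ t" for t
    using reward_binary[OF assms, of t] \<gamma>_bounds by auto
qed

lemma discounted_return_integrable:
  assumes s: "s \<in> space S"
  shows "integrable (rollout_law S A P H \<pi>act \<pi>len s) (\<lambda>\<omega>. \<Sum>t. \<gamma> ^ t * reward_at R \<omega> t)"
proof -
  interpret prob_space "rollout_law S A P H \<pi>act \<pi>len s"
    by (rule prob_space_rollout_law[OF s])
  note sp = sets_eq_imp_space_eq[OF sets_rollout_law[OF s]]
  show ?thesis
  proof (rule integrable_const_bound[where B = "\<Sum>t. \<gamma> ^ t"])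
    have "norm (\<Sum>t. \<gamma> ^ t * reward_at R \<omega> t) \<le> (\<Sum>t. \<gamma> ^ t)"
      if "\<omega> \<in> space (PiM UNIV (\<lambda>_. config_space S A H))" for \<omega>
    proof (rule norm_suminf_le)
      show "norm (\<gamma> ^ t * reward_at R \<omega> t) \<le> \<gamma> ^ t" for t
        using reward_binary[OF that, of t] \<gamma>_bounds by auto
      show "summable (\<lambda>t. \<gamma> ^ t)"
        using \<gamma>_bounds by (intro summable_geometric) auto
    qed
    then show "AE \<omega> in rollout_law S A P H \<pi>act \<pi>len s.
        norm (\<Sum>t. \<gamma> ^ t * reward_at R \<omega> t) \<le> (\<Sum>t. \<gamma> ^ t)"
      by (intro AE_I2) (simp add: sp)
    have "(\<lambda>\<omega>. \<Sum>t. \<gamma> ^ t * reward_at R \<omega> t) \<in> borel_measurable (PiM UNIV (\<lambda>_. config_space S A H))"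
      by (intro borel_measurable_suminf borel_measurable_times borel_measurable_const reward_measurable)
    then show "(\<lambda>\<omega>. \<Sum>t. \<gamma> ^ t * reward_at R \<omega> t)
        \<in> borel_measurable (rollout_law S A P H \<pi>act \<pi>len s)"
      by (simp add: measurable_cong_sets[OF sets_rollout_law[OF s] refl])
  qed
qed

end

end

theory Submission
  imports Defs
begin

text \<open>
  The identity holds for every trajectory: horizons are positive, so the chunk start times increase
  strictly, and the partial sums of the chunked series form a subsequence of the partial sums of
  the discounted return, which converges.
\<close>

text \<open>The bound is built into the space: the horizon component of \<open>config_space\<close>
  ranges over \<open>{1..H}\<close>. It therefore holds at every time along every point of the
  product space, not just almost surely.\<close>

lemma horizon_at_pos:
  assumes "\<omega> \<in> space (PiM UNIV (\<lambda>_. config_space S A H))"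
  shows "0 < horizon_at \<omega> t"
proof -
  have "\<omega> t \<in> space (config_space S A H)"
    using assms by (auto simp: space_PiM)
  then show ?thesis
    by (auto simp: horizon_at_def config_space_def horizon_space_def space_pair_measure)
qed

lemma strict_mono_chunk_start:
  assumes "\<And>t. 0 < horizon_at \<omega> t"
  shows "strict_mono (chunk_start \<omega>)"
  using assms by (simp add: strict_mono_Suc_iff)

text \<open>Consecutive chunks tile the steps before the \<open>n\<close>-th start time, and the two
  discounts multiply to the discount of the absolute time
  \<open>chunk_start \<omega> k + j\<close>.\<close>

lemma sum_chunk_reward:
  "(\<Sum>k<n. \<gamma> ^ chunk_start \<omega> k * chunk_reward R \<gamma> \<omega> k) =
   (\<Sum>t<chunk_start \<omega> n. \<gamma> ^ t * reward_at R \<omega> t)"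
proof (induction n)
  case (Suc n)
  \<comment> \<open>Used with \<open>m\<close> the start of chunk \<open>n\<close> and
    \<open>l\<close> its horizon, so that the second sum is the contribution of that chunk.\<close>
  have "(\<Sum>t<m + l. f t) = (\<Sum>t<m. f t) + (\<Sum>j<l. f (m + j))" for m l and f :: "nat \<Rightarrow> real"
    by (induction l) (simp_all add: add.assoc)
  with Suc show ?case
    by (simp add: chunk_reward_def chunk_horizon_def sum_distrib_left power_add mult.assoc)
qed simp

lemma suminf_chunk_reward:
  assumes "\<And>t. 0 < horizon_at \<omega> t" and "summable (\<lambda>t. \<gamma> ^ t * reward_at R \<omega> t)"
  shows "(\<Sum>k. \<gamma> ^ chunk_start \<omega> k * chunk_reward R \<gamma> \<omega> k) = (\<Sum>t. \<gamma> ^ t * reward_at R \<omega> t)"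
proof (rule sums_unique[symmetric])
  \<comment> \<open>The subsequence is indexed by \<open>chunk_start \<omega>\<close>; convergence
    of the chunked series is obtained here together with its value.\<close>
  from LIMSEQ_subseq_LIMSEQ[OF summable_LIMSEQ[OF assms(2)] strict_mono_chunk_start[OF assms(1)]]
  show "(\<lambda>k. \<gamma> ^ chunk_start \<omega> k * chunk_reward R \<gamma> \<omega> k) sums (\<Sum>t. \<gamma> ^ t * reward_at R \<omega> t)"
    by (simp add: sums_def sum_chunk_reward o_def)
qed

theorem proposition1:
  fixes S :: "'s measure" and A :: "'a measure"
    and P :: "'s \<times> 'a \<Rightarrow> 's measure" and R :: "'s \<times> 'a \<times> 's \<Rightarrow> real" and \<gamma> :: real
    and H :: nat
    and \<pi>act :: "'s \<Rightarrow> (nat \<Rightarrow> 'a) measure"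
    and \<pi>len :: "'s \<times> (nat \<Rightarrow> 'a) \<Rightarrow> nat measure"
    and s :: 's
  assumes "binary_mdp S A P R \<gamma>"
    and "chunking_policy S A H \<pi>act \<pi>len"
    and "s \<in> space S"
  shows "(\<integral>\<omega>. (\<Sum>k. \<gamma> ^ chunk_start \<omega> k * chunk_reward R \<gamma> \<omega> k) \<partial>rollout_law S A P H \<pi>act \<pi>len s) =
         (\<integral>\<omega>. (\<Sum>t. \<gamma> ^ t * reward_at R \<omega> t) \<partial>rollout_law S A P H \<pi>act \<pi>len s)"
proof (rule Bochner_Integration.integral_cong[OF refl])
  interpret chunked_rollout S A P R \<gamma> H \<pi>act \<pi>len
    by (intro chunked_rollout.intro assms)
  fix \<omega> assume "\<omega> \<in> space (rollout_law S A P H \<pi>act \<pi>len s)"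
  \<comment> \<open>Membership in the product space supplies both positive horizons and binary
    rewards, hence summability.\<close>
  then have \<omega>: "\<omega> \<in> space (PiM UNIV (\<lambda>_. config_space S A H))"
    by (simp add: sets_eq_imp_space_eq[OF sets_rollout_law[OF assms(3)]])
  show "(\<Sum>k. \<gamma> ^ chunk_start \<omega> k * chunk_reward R \<gamma> \<omega> k) = (\<Sum>t. \<gamma> ^ t * reward_at R \<omega> t)"
    by (rule suminf_chunk_reward[OF horizon_at_pos[OF \<omega>] discounted_summable[OF \<omega>]])
qed

end
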